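(* Let $d \geq 1$ and $m \geq 2$ be integers, let $\lambda = (\lambda_1, \dots, \lambda_m)$ be a weight, let $-\infty \leq p \leq 1/d$, and let $-\infty \leq \widetilde{Q} < Q_d(p)$. Then there exist integrable functions $f_1, \dots, f_m, g_1, \dots, g_m \colon \mathbb{R}^d \to \mathbb{R}_{\geq 0}$ with $0 < \| f_i \|_1 < \infty$ for every $i = 1, \dots, m$ such that $$K > M_{\widetilde{Q}}^\lambda \left( \frac{\| g_1 \|_1}{\| f_1 \|_1}, \dots, \frac{\| g_m \|_1}{\| f_m \|_1} \right),$$ where $S = S(f_1) \times \dots \times S(f_m)$ and $$K = \operatorname*{ess\,inf}_{x = (x_1, \dots, x_m) \in S} M_p^\lambda \left( \frac{g_1(z_\lambda(x))}{f_1(x_1)}, \dots, \frac{g_m(z_\lambda(x))}{f_m(x_m)} \right),$$ the essential infimum being with respect to Lebesgue measure on $S$.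
   Context: A weight is a tuple $\lambda = (\lambda_1, \dots, \lambda_m)$ of positive real numbers with $\sum_{i=1}^m \lambda_i = 1$. For a weight $\lambda$ and $-\infty \leq p \leq \infty$, the weighted power mean $M_p^\lambda \colon \mathbb{R}_{\geq 0}^m \to \mathbb{R}_{\geq 0}$ is defined by: $M_0^\lambda(a) = \prod_{i=1}^m a_i^{\lambda_i}$; $M_{-\infty}^\lambda(a) = \min_i a_i$; $M_\infty^\lambda(a) = \max_i a_i$; $M_p^\lambda(a) = 0$ if $-\infty \leq p \leq 0$ and $\prod_{i=1}^m a_i = 0$; and $M_p^\lambda(a) = \left( \sum_{i=1}^m \lambda_i a_i^p \right)^{1/p}$ otherwise. For $x = (x_1, \dots, x_m) \in (\mathbb{R}^d)^m$, $z_\lambda(x) = \sum_{i=1}^m \lambda_i x_i \in \mathbb{R}^d$. For $f \colon \mathbb{R}^d \to \mathbb{R}_{\geq 0}$, $S(f) = \{ x \in \mathbb{R}^d \mid f(x) > 0 \}$, and $\| f \|_1$ is the $L^1$ norm with respect to Lebesgue measure. The power transform $Q_d \colon [-\infty, 1/d] \to [-\infty, \infty]$ is $Q_d(p) = \frac{p}{1 - dp}$ for $-\infty < p < 1/d$, $Q_d(-\infty) = -1/d$, and $Q_d(1/d) = \infty$. *)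

theory Defs
  imports "HOL-Analysis.Analysis" "HOL-Probability.Essential_Supremum"
begin

text \<open>
  An \<open>m\<close>-tuple is a function on a finite index type \<open>'m\<close> with \<open>CARD('m) = m\<close>. Only tuples of points
  of \<open>\<real>\<^sup>d\<close> are vectors of vectors \<open>real^'d^'m\<close>, so that they carry Lebesgue measure.
\<close>

definition is_weight :: "('m::finite \<Rightarrow> real) \<Rightarrow> bool" where
  "is_weight l \<longleftrightarrow> (\<forall>i. 0 < l i) \<and> (\<Sum>i\<in>UNIV. l i) = 1"

text \<open>
  Meant for a weight \<open>l\<close> and nonnegative \<open>a\<close>. Since \<open>0 powr x = 0\<close> for every \<open>x\<close>, the formulas agree
  with the usual powers: the bases can vanish only where the exponent is positive.
\<close>

definition power_mean :: "('m::finite \<Rightarrow> real) \<Rightarrow> ereal \<Rightarrow> ('m \<Rightarrow> real) \<Rightarrow> real" where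
  "power_mean l p a =
    (if p = 0 then \<Prod>i\<in>UNIV. a i powr l i
     else if p = -\<infinity> then Min (range a)
     else if p = \<infinity> then Max (range a)
     else if p \<le> 0 \<and> (\<Prod>i\<in>UNIV. a i) = 0 then 0
     else (\<Sum>i\<in>UNIV. l i * a i powr real_of_ereal p) powr (1 / real_of_ereal p))"

definition weighted_point :: "('m::finite \<Rightarrow> real) \<Rightarrow> real^'d^'m \<Rightarrow> real^'d" where
  "weighted_point l x = (\<Sum>i\<in>UNIV. l i *\<^sub>R (x $ i))"

definition pos_set :: "('a \<Rightarrow> real) \<Rightarrow> 'a set" where
  "pos_set f = {x. 0 < f x}"

text \<open>The \<open>L\<^sup>1\<close> norm of an integrable function; for such functions it is automatically finite.\<close>

definition L1_norm :: "(real^'d \<Rightarrow> real) \<Rightarrow> real" where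
  "L1_norm f = (\<integral>x. \<bar>f x\<bar> \<partial>lebesgue)"

text \<open>Meant for \<open>p \<le> 1/d\<close> only.\<close>

definition power_transform :: "nat \<Rightarrow> ereal \<Rightarrow> ereal" where
  "power_transform d p =
    (if p = -\<infinity> then ereal (- 1 / real d)
     else if p = ereal (1 / real d) then \<infinity>
     else ereal (real_of_ereal p / (1 - real d * real_of_ereal p)))"

text \<open>
  The largest \<open>c\<close> with \<open>c \<le> f x\<close> for almost every \<open>x\<close>, if \<open>f\<close> is measurable; following the convention
  of \<^const>\<open>esssup\<close>, it is \<open>-\<infinity>\<close> if \<open>f\<close> is not measurable.
\<close>

definition essinf :: "'a measure \<Rightarrow> ('a \<Rightarrow> ereal) \<Rightarrow> ereal" where
  "essinf M f = - esssup M (\<lambda>x. - f x)"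

end

theory Submission imports Defs begin

text \<open>
  Take \<open>f\<^sub>i\<close> to be the indicator function of the ball of radius \<open>r\<^sub>i\<close> about \<open>0\<close> and \<open>g\<^sub>i\<close> to be \<open>t\<^sub>i\<close> times
  that of the ball of radius \<open>R = \<Sum>\<^sub>i \<lambda>\<^sub>i r\<^sub>i\<close>. Then \<open>K = M\<^sub>p(t)\<close>, and the ratio of the norms is
  \<open>t\<^sub>i (R / r\<^sub>i)\<^sup>d\<close>. Let \<open>t\<close> and \<open>r\<close> be \<open>1\<close> at a single index of weight \<open>w\<close>. At the other indices let \<open>r\<close>
  tend to \<open>0\<close>, and let \<open>t\<close> be \<open>0\<close> if \<open>p > 0\<close> and tend to infinity if \<open>p \<le> 0\<close>. For \<open>p \<noteq> 0\<close>, and \<open>q > 0\<close>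
  if \<open>p > 0\<close>, the two means are asymptotically \<open>w\<^bsup>1/p\<^esup>\<close> and at most \<open>w\<^bsup>d + 1/q\<^esup>\<close>, where
  \<open>1/p < d + 1/q\<close> is just a form of \<open>q < Q\<^sub>d(p)\<close>.
\<close>

section \<open>Reduction to an inequality between two power means\<close>

text \<open>Only an upper bound, since over a null set the essential supremum is
  \<open>-\<infinity>\<close>. Applied to a negated function it becomes a lower bound for
  \<open>essinf\<close>, which is the direction wanted.\<close>

lemma esssup_lebesgue_on_const_le:
  fixes F :: "'a::euclidean_space \<Rightarrow> ereal"
  assumes "\<And>x. x \<in> S \<Longrightarrow> F x = c"
  shows "esssup (lebesgue_on S) F \<le> c"
proof (rule esssup_I)
  have "F x = c" if "x \<in> space (lebesgue_on S)" for x
    using that assms by simp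
  then show "F \<in> borel_measurable (lebesgue_on S)"
    using measurable_cong[of "lebesgue_on S" F "\<lambda>_. c" borel] by simp
  show "AE x in lebesgue_on S. F x \<le> c"
    using assms by (intro AE_I2) simp
qed

lemma L1_norm_indicator_ball:
  assumes "0 \<le> t" "0 \<le> r"
  shows "L1_norm (\<lambda>x. t * indicator (ball (0::real^'d) r) x) = t * (unit_ball_vol CARD('d) * r ^ CARD('d))"
proof -
  have "L1_norm (\<lambda>x. t * indicator (ball (0::real^'d) r) x)
      = (\<integral>x. t * indicator (ball (0::real^'d) r) x \<partial>lebesgue)"
    using assms unfolding L1_norm_def by (intro Bochner_Integration.integral_cong) auto
  also have "\<dots> = t * measure lebesgue (ball (0::real^'d) r)"
    by simp
  finally show ?thesis
    using assms by (simp add: content_ball)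
qed

lemma norm_weighted_point_less:
  assumes "is_weight l" "\<And>i. norm (x $ i) < r i"
  shows "norm (weighted_point l x) < (\<Sum>i\<in>UNIV. l i * r i)"
proof -
  have "norm (weighted_point l x) \<le> (\<Sum>i\<in>UNIV. norm (l i *\<^sub>R (x $ i)))"
    unfolding weighted_point_def by (rule norm_sum)
  also have "\<dots> < (\<Sum>i\<in>UNIV. l i * r i)"
    using assms by (intro sum_strict_mono) (auto simp: is_weight_def abs_of_pos)
  finally show ?thesis .
qed

lemma exists_functions_if_power_mean_less:
  fixes l t r :: "'m::finite \<Rightarrow> real"
  assumes l: "is_weight l" and t: "\<And>i. 0 \<le> t i" and r: "\<And>i. 0 < r i"
    and R: "R = (\<Sum>i\<in>UNIV. l i * r i)"
    and less: "power_mean l q (\<lambda>i. t i * (R / r i) ^ CARD('d::finite)) < power_mean l p t"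
  shows "\<exists>(f :: 'm \<Rightarrow> real^'d \<Rightarrow> real) (g :: 'm \<Rightarrow> real^'d \<Rightarrow> real).
    (\<forall>i. (\<forall>x. 0 \<le> f i x) \<and> (\<forall>x. 0 \<le> g i x) \<and>
         integrable lebesgue (f i) \<and> integrable lebesgue (g i) \<and> 0 < L1_norm (f i)) \<and>
    essinf (lebesgue_on {x :: real^'d^'m. \<forall>i. x $ i \<in> pos_set (f i)})
        (\<lambda>x. ereal (power_mean l p (\<lambda>i. g i (weighted_point l x) / f i (x $ i))))
      > ereal (power_mean l q (\<lambda>i. L1_norm (g i) / L1_norm (f i)))"
proof -
  \<comment> \<open>The factor \<open>1\<close> lets \<open>L1_norm_indicator_ball\<close> apply to
    \<open>f\<close> as well as to \<open>g\<close>.\<close>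
  define f where "f = (\<lambda>i x. 1 * indicator (ball (0::real^'d) (r i)) x :: real)"
  define g where "g = (\<lambda>i x. t i * indicator (ball (0::real^'d) R) x :: real)"
  have R_nonneg: "0 \<le> R"
    unfolding R using l r by (intro sum_nonneg) (simp add: is_weight_def less_imp_le)
  have vol: "0 < unit_ball_vol (real CARD('d))"
    by simp
  have norm_f: "L1_norm (f i) = unit_ball_vol CARD('d) * r i ^ CARD('d)" for i
    unfolding f_def using r[of i] by (subst L1_norm_indicator_ball) auto
  have norm_g: "L1_norm (g i) = t i * (unit_ball_vol CARD('d) * R ^ CARD('d))" for i
    unfolding g_def using t R_nonneg by (subst L1_norm_indicator_ball) auto
  have ratio: "L1_norm (g i) / L1_norm (f i) = t i * (R / r i) ^ CARD('d)" for i
    using less_imp_neq[OF vol] r[of i] by (simp add: norm_f norm_g power_divide)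
  have props: "(\<forall>x. 0 \<le> f i x) \<and> (\<forall>x. 0 \<le> g i x) \<and>
      integrable lebesgue (f i) \<and> integrable lebesgue (g i) \<and> 0 < L1_norm (f i)" for i
  proof (intro conjI)
    show "integrable lebesgue (f i)"
      unfolding f_def by (intro integrable_mult_right integrable_real_indicator)
        (use lmeasurable_ball in \<open>auto simp: fmeasurable_def\<close>)
    show "integrable lebesgue (g i)"
      unfolding g_def by (intro integrable_mult_right integrable_real_indicator)
        (use lmeasurable_ball in \<open>auto simp: fmeasurable_def\<close>)
    show "0 < L1_norm (f i)"
      using vol r by (simp add: norm_f)
  qed (use t in \<open>auto simp: f_def g_def\<close>)
  let ?S = "{x :: real^'d^'m. \<forall>i. x $ i \<in> pos_set (f i)}"
  let ?F = "\<lambda>x. ereal (power_mean l p (\<lambda>i. g i (weighted_point l x) / f i (x $ i)))"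
  \<comment> \<open>On \<open>?S\<close> every denominator is 1 and the weighted point lies in the
    ball of radius \<open>R\<close>, so the \<open>i\<close>-th quotient is
    \<open>t i\<close>.\<close>
  have "?F x = ereal (power_mean l p t)" if "x \<in> ?S" for x
  proof -
    have x: "norm (x $ i) < r i" for i
      using that by (auto simp: pos_set_def f_def indicator_def split: if_splits)
    then have "norm (weighted_point l x) < R"
      unfolding R using l by (intro norm_weighted_point_less)
    with x show ?thesis
      by (simp add: f_def g_def)
  qed
  then have "esssup (lebesgue_on ?S) (\<lambda>x. - ?F x) \<le> - ereal (power_mean l p t)"
    by (intro esssup_lebesgue_on_const_le) simp
  then have "ereal (power_mean l p t) \<le> essinf (lebesgue_on ?S) ?F"
    unfolding essinf_def using ereal_minus_le_minus by fastforce
  moreover have "ereal (power_mean l q (\<lambda>i. L1_norm (g i) / L1_norm (f i)))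
      < ereal (power_mean l p t)"
    using less by (simp add: ratio)
  ultimately have "ereal (power_mean l q (\<lambda>i. L1_norm (g i) / L1_norm (f i)))
      < essinf (lebesgue_on ?S) ?F"
    by (rule less_le_trans[rotated])
  with props show ?thesis
    by blast
qed

section \<open>Estimates for weights, power means and exponents\<close>

lemma sum_weight_if:
  assumes "is_weight l"
  shows "(\<Sum>i\<in>UNIV. l i * (if i = j then a else b)) = l j * a + (1 - l j) * b"
proof -
  have "(\<Sum>i\<in>UNIV. l i * (if i = j then a else b)) = l j * a + (\<Sum>i\<in>UNIV - {j}. l i * b)"
    by (subst sum.remove[of _ j]) auto
  also have "(\<Sum>i\<in>UNIV - {j}. l i * b) = (1 - l j) * b"
    using assms by (simp add: is_weight_def sum_diff1 flip: sum_distrib_right)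
  finally show ?thesis .
qed

text \<open>A base below 1 makes \<open>l j powr x\<close> strictly decreasing in \<open>x\<close>,
  so that a strict inequality between exponents yields one between limits.\<close>

lemma weight_less_1:
  fixes l :: "'m::finite \<Rightarrow> real"
  assumes "is_weight l" "CARD('m) \<ge> 2"
  shows "l j < 1"
proof -
  have "UNIV - {j} \<noteq> {}"
  proof
    assume "UNIV - {j} = {}"
    then have "CARD('m) \<le> card {j}"
      by (intro card_mono) auto
    then show False
      using assms(2) by simp
  qed
  then have "0 < (\<Sum>i\<in>UNIV - {j}. l i)"
    using assms(1) by (intro sum_pos) (auto simp: is_weight_def)
  then show ?thesis
    using assms(1) by (simp add: is_weight_def sum_diff1)
qed

text \<open>For \<open>q = -\<infinity>\<close> the exponent below is \<open>1 / 0 = 0\<close>.\<close>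

lemma power_mean_neg_le:
  assumes l: "is_weight l" and q: "q < 0" and b: "\<And>i. 0 < b i"
  shows "power_mean l q b \<le> l j powr (1 / real_of_ereal q) * b j"
proof (cases q)
  case (real s)
  have lj: "0 < l j" "0 < b j"
    using l b by (auto simp: is_weight_def)
  have s: "s < 0"
    using q real by simp
  \<comment> \<open>The outer exponent \<open>1 / s\<close> is negative, so dropping the other terms
    of the sum can only increase the power.\<close>
  have "l j * b j powr s \<le> (\<Sum>i\<in>UNIV. l i * b i powr s)"
    using l by (intro member_le_sum) (auto simp: is_weight_def less_imp_le)
  then have "(\<Sum>i\<in>UNIV. l i * b i powr s) powr (1 / s) \<le> (l j * b j powr s) powr (1 / s)"
    using s lj by (intro powr_mono2') auto
  also have "\<dots> = l j powr (1 / s) * b j"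
    using s lj by (simp add: powr_mult powr_powr)
  finally show ?thesis
    using s b real by (simp add: power_mean_def less_imp_neq[symmetric] zero_ereal_def)
next
  case MInf
  \<comment> \<open>The factor \<open>l j powr 0\<close> is 1 only for a nonzero base, since
    \<open>0 powr 0 = 0\<close>.\<close>
  have "l j \<noteq> 0"
    using l by (auto simp: is_weight_def dest: spec[of _ j])
  then show ?thesis
    using MInf by (simp add: power_mean_def)
qed (use q in simp)

lemma power_mean_single:
  fixes l :: "'m::finite \<Rightarrow> real"
  assumes l: "is_weight l" and q: "0 < q" "q \<noteq> \<infinity>" and b: "0 \<le> b"
  shows "power_mean l q (\<lambda>i. if i = j then b else 0) = l j powr (1 / real_of_ereal q) * b"
proof (cases q)
  case (real s)
  have s: "0 < s"
    using q real by simp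
  have "(\<Sum>i\<in>UNIV. l i * (if i = j then b else 0) powr s) = l j * b powr s"
    using sum_weight_if[OF l, of j "b powr s" 0] by (simp add: if_distrib[of "\<lambda>x. x powr s"] cong: if_cong)
  then show ?thesis
    using s real l b
    by (simp add: power_mean_def powr_mult powr_powr is_weight_def less_imp_le zero_ereal_def)
qed (use q in auto)

lemma power_mean_nonpos_eq_0:
  assumes q: "q \<le> 0" and b: "\<And>i. 0 \<le> b i" and k: "b k = 0"
  shows "power_mean l q b = 0"
proof -
  have "Min (range b) = 0"
    using b k by (intro Min_eqI) (auto intro: range_eqI[of _ b k])
  moreover have "(\<Prod>i\<in>UNIV. b i) = 0" "(\<Prod>i\<in>UNIV. b i powr l i) = 0"
    using k by (auto intro!: exI[of _ k])
  ultimately show ?thesis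
    using q by (auto simp: power_mean_def)
qed

text \<open>If \<open>p\<close> or \<open>q\<close> is \<open>-\<infinity>\<close>, then its inverse below is \<open>1 / 0 = 0\<close>, as it should be.\<close>

lemma inverse_exponent_less:
  assumes d: "0 < d" and p: "p \<le> ereal (1 / real d)" "p \<noteq> 0"
    and q: "q < power_transform d p" and pos: "p < 0 \<or> 0 < q"
  shows "1 / real_of_ereal p < real d + 1 / real_of_ereal q"
proof (cases p)
  case MInf
  show ?thesis
  proof (cases q)
    case (real s)
    then have s: "s < - (1 / real d)"
      using q MInf by (simp add: power_transform_def)
    then have "s < 0"
      using d by (smt (verit) divide_pos_pos of_nat_0_less_iff zero_less_one)
    then show ?thesis
      using s d real MInf by (simp add: field_simps)
  qed (use q MInf d in \<open>auto simp: power_transform_def\<close>)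
next
  case (real u)
  then have u: "u \<le> 1 / real d" "u \<noteq> 0"
    using p by (auto simp: zero_ereal_def)
  show ?thesis
  proof (cases "u = 1 / real d")
    \<comment> \<open>At this endpoint \<open>1 / p = d\<close>, so only \<open>1 / q > 0\<close> is
      left to show. That \<open>q\<close> is finite matters: for \<open>q = \<infinity>\<close> the
      quotient would be \<open>1 / 0 = 0\<close>.\<close>
    case True
    then have "0 < q" "q \<noteq> \<infinity>"
      using q pos real d by (auto simp: divide_less_0_iff)
    then have "0 < real_of_ereal q"
      by (cases q) auto
    then show ?thesis
      using True real by simp
  next
    case False
    \<comment> \<open>The transform of \<open>p\<close> is \<open>u / v\<close>, and
      \<open>1 / u = d + v / u\<close>. So for finite \<open>q = s\<close> the claim is
      \<open>v / u < 1 / s\<close>, the reciprocal of \<open>s < u / v\<close>. Both sides have the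
      same sign: if \<open>u < 0\<close>, then \<open>s < u / v < 0\<close>; otherwise
      \<open>pos\<close> gives \<open>s > 0\<close>.\<close>
    define v where "v = 1 - real d * u"
    have v: "0 < v"
      using u d False by (simp add: v_def field_simps)
    have q': "q < ereal (u / v)"
      using q False real by (simp add: power_transform_def v_def)
    have inv: "1 / u = real d + v / u"
      using u by (simp add: v_def field_simps)
    show ?thesis
    proof (cases q)
      case (real s)
      have "v / u < 1 / s"
      proof (cases "u < 0")
        case True
        then have "s < 0"
          using q' real v by (smt (verit) divide_neg_pos less_ereal.simps(1))
        then show ?thesis
          using q' real True v by (simp add: field_simps)
      next
        case False
        then have "0 < s" "0 < u"
          using pos u real \<open>p = ereal u\<close> by auto
        then show ?thesis
          using q' real v by (simp add: field_simps)
      qed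
      then show ?thesis
        using inv real \<open>p = ereal u\<close> by simp
    next
      case MInf
      then have "u < 0"
        using pos \<open>p = ereal u\<close> by simp
      then have "1 / u < 0"
        by simp
      then show ?thesis
        using MInf \<open>p = ereal u\<close> d by (simp add: less_trans[of _ 0])
    qed (use q' in simp)
  qed
qed (use p in simp)

section \<open>Limits as the other radii tend to 0\<close>

text \<open>Here \<open>w + (1 - w) * s\<close> is the radius \<open>R\<close> when one index of
  weight \<open>w\<close> has radius 1 and the others have radius \<open>s\<close>. Its limit
  \<open>w\<close> contributes the \<open>d\<close> in the exponent.\<close>

lemma tendsto_radius_power:
  assumes "0 < (w::real)"
  shows "((\<lambda>s. (w + (1 - w) * s) ^ d * w powr e) \<longlongrightarrow> w powr (real d + e)) (at_right 0)"
proof -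
  have "((\<lambda>s. (w + (1 - w) * s) ^ d * w powr e) \<longlongrightarrow> (w + (1 - w) * 0) ^ d * w powr e) (at_right 0)"
    by (intro tendsto_intros)
  then show ?thesis
    using assms by (simp add: powr_add powr_realpow)
qed

text \<open>The right side is the constant \<open>l j powr (1 / p)\<close>, and by
  \<open>inverse_exponent_less\<close> the left side has a smaller limit.\<close>

lemma eventually_radius_power_less_pos:
  assumes l: "is_weight l" and less1: "l j < 1" and d: "0 < d"
    and p: "0 < p" "p \<le> ereal (1 / real d)" and q: "q < power_transform d p" "0 < q"
  shows "\<forall>\<^sub>F s in at_right 0.
    (l j + (1 - l j) * s) ^ d * l j powr (1 / real_of_ereal q)
      < power_mean l p (\<lambda>i. if i = j then 1 else 0)"
proof -
  have "p \<noteq> \<infinity>"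
    using p by auto
  moreover have "0 < l j"
    using l by (simp add: is_weight_def)
  moreover have "1 / real_of_ereal p < real d + 1 / real_of_ereal q"
    using assms by (intro inverse_exponent_less) auto
  ultimately show ?thesis
    using l p less1 by (intro order_tendstoD[OF tendsto_radius_power])
      (auto simp: power_mean_single intro!: powr_less_mono')
qed

text \<open>The left side has a finite limit. For \<open>p = 0\<close> the right side is unbounded;
  for \<open>p < 0\<close> it tends to \<open>l j powr (1 / p)\<close>, which exceeds that
  limit.\<close>

lemma eventually_radius_power_less_nonpos:
  assumes l: "is_weight l" and less1: "l j < 1" and d: "0 < d"
    and p: "p \<le> 0" and q: "q < power_transform d p"
  shows "\<forall>\<^sub>F s in at_right 0.
    (l j + (1 - l j) * s) ^ d * l j powr (1 / real_of_ereal q)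
      < power_mean l p (\<lambda>i. if i = j then 1 else 1 / s)"
proof -
  let ?w = "l j" and ?e = "1 / real_of_ereal q"
  let ?A = "\<lambda>s. (?w + (1 - ?w) * s) ^ d * ?w powr ?e"
  let ?B = "\<lambda>s. power_mean l p (\<lambda>i. if i = j then 1 else 1 / s)"
  have w: "0 < ?w"
    using l by (simp add: is_weight_def)
  have small: "\<forall>\<^sub>F s in at_right (0::real). 0 < s \<and> s < 1"
    by (auto simp: eventually_at_right_field intro!: exI[of _ 1])
  have inf: "LIM s at_right (0::real). 1 / s :> at_top"
    using filterlim_inverse_at_top_right by (simp add: inverse_eq_divide)
  show ?thesis
  proof (cases "p = 0")
    case True
    have "?B s = (1 / s) powr (1 - ?w)" if "0 < s" for s
    proof -
      have "(\<Prod>i\<in>UNIV. (if i = j then 1 else 1 / s) powr l i)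
          = (\<Prod>i\<in>UNIV - {j}. (1 / s) powr l i)"
        by (subst prod.remove[of _ j]) auto
      also have "\<dots> = (1 / s) powr (\<Sum>i\<in>UNIV - {j}. l i)"
        using that by (intro powr_sum[symmetric]) auto
      finally show ?thesis
        using True l by (simp add: power_mean_def is_weight_def sum_diff1)
    qed
    then have B: "\<forall>\<^sub>F s in at_right 0. ?B s = (1 / s) powr (1 - ?w)"
      using small by (auto elim: eventually_mono)
    \<comment> \<open>\<open>?c\<close> is a bound above the limit of \<open>?A\<close>; solving
      \<open>?c = (1 / s) powr (1 - ?w)\<close> for \<open>1 / s\<close> gives the threshold
      below.\<close>
    have c: "0 < ?w powr (real d + ?e) + 1" (is "0 < ?c")
      by (simp add: add_nonneg_pos)
    have "\<forall>\<^sub>F s in at_right 0. ?c powr (1 / (1 - ?w)) < 1 / s"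
      using inf by (simp add: filterlim_at_top_dense)
    then have "\<forall>\<^sub>F s in at_right 0. ?c < (1 / s) powr (1 - ?w)"
    proof eventually_elim
      case (elim s)
      then have "(?c powr (1 / (1 - ?w))) powr (1 - ?w) < (1 / s) powr (1 - ?w)"
        using less1 by (intro powr_less_mono2) auto
      then show ?case
        using c less1 by (simp add: powr_powr)
    qed
    moreover have "\<forall>\<^sub>F s in at_right 0. ?A s < ?w powr (real d + ?e) + 1"
      using w by (intro order_tendstoD[OF tendsto_radius_power]) auto
    ultimately show ?thesis
      using B by eventually_elim simp
  next
    case False
    then have neg: "p < 0"
      using p by simp
    have "p \<le> ereal (1 / real d)"
      using p by (rule order_trans) simp
    then have less: "1 / real_of_ereal p < real d + ?e"
      using d q neg by (intro inverse_exponent_less) auto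
    have "(?B \<longlongrightarrow> ?w powr (1 / real_of_ereal p)) (at_right 0)"
    proof (cases p)
      case (real u)
      have u: "u < 0"
        using neg real by simp
      have "?B s = (?w + (1 - ?w) * (1 / s) powr u) powr (1 / u)" if "0 < s" for s
      proof -
        have "(\<Prod>i\<in>UNIV. if i = j then 1 else 1 / s) \<noteq> 0"
          using that by simp
        moreover have "(\<Sum>i\<in>UNIV. l i * (if i = j then 1 else 1 / s) powr u)
            = ?w + (1 - ?w) * (1 / s) powr u"
          using sum_weight_if[OF l, of j 1 "(1 / s) powr u"]
          by (simp add: if_distrib[of "\<lambda>x. x powr u"] cong: if_cong)
        ultimately show ?thesis
          using real u by (simp add: power_mean_def zero_ereal_def)
      qed
      then have B: "\<forall>\<^sub>F s in at_right 0. (?w + (1 - ?w) * (1 / s) powr u) powr (1 / u) = ?B s"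
        using small by (auto elim: eventually_mono)
      \<comment> \<open>Since \<open>u < 0\<close>, \<open>(1 / s) powr u\<close> tends to 0, and
        only the term of index \<open>j\<close> survives.\<close>
      have "((\<lambda>s. (?w + (1 - ?w) * (1 / s) powr u) powr (1 / u))
          \<longlongrightarrow> (?w + (1 - ?w) * 0) powr (1 / u)) (at_right 0)"
        using w by (intro tendsto_powr tendsto_add tendsto_mult tendsto_const
            tendsto_neg_powr[OF u inf]) simp
      from Lim_transform_eventually[OF this B] show ?thesis
        using real by simp
    next
      case MInf
      \<comment> \<open>As \<open>1 / s > 1\<close>, the minimum is the entry at \<open>j\<close>;
        it agrees with \<open>?w powr (1 / 0) = 1\<close>.\<close>
      have "?B s = 1" if "0 < s \<and> s < 1" for s
      proof -
        have "Min (range (\<lambda>i. if i = j then 1 else 1 / s)) = 1"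
          using that by (intro Min_eqI) (auto intro: range_eqI[of _ _ j])
        then show ?thesis
          using MInf by (simp add: power_mean_def)
      qed
      then have "\<forall>\<^sub>F s in at_right 0. 1 = ?B s"
        using small by (auto elim: eventually_mono)
      from Lim_transform_eventually[OF tendsto_const this] show ?thesis
        using MInf w by simp
    qed (use p in simp)
    moreover have "?w powr (real d + ?e) < ?w powr (1 / real_of_ereal p)"
      using w less1 less by (intro powr_less_mono')
    \<comment> \<open>Both sides vary with \<open>s\<close>, so a constant between their limits
      separates them.\<close>
    ultimately obtain c where c: "?w powr (real d + ?e) < c" "c < ?w powr (1 / real_of_ereal p)"
      and B: "(?B \<longlongrightarrow> ?w powr (1 / real_of_ereal p)) (at_right 0)"
      using dense by blast
    have "\<forall>\<^sub>F s in at_right 0. ?A s < c"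
      using w c by (intro order_tendstoD[OF tendsto_radius_power])
    moreover have "\<forall>\<^sub>F s in at_right 0. c < ?B s"
      using order_tendstoD(1)[OF B c(2)] .
    ultimately show ?thesis
      by eventually_elim simp
  qed
qed

section \<open>Choice of the heights and radii\<close>

lemma exists_power_mean_less:
  fixes l :: "'m::finite \<Rightarrow> real"
  assumes card: "CARD('m) \<ge> 2" and l: "is_weight l" and d: "0 < d"
    and p: "p \<le> ereal (1 / real d)" and q: "q < power_transform d p"
  shows "\<exists>t r. (\<forall>i. 0 \<le> t i) \<and> (\<forall>i. 0 < r i) \<and>
    power_mean l q (\<lambda>i. t i * ((\<Sum>k\<in>UNIV. l k * r k) / r i) ^ d) < power_mean l p t"
proof -
  obtain j k :: 'm where jk: "j \<noteq> k"
    using card card_le_Suc0_iff_eq[of "UNIV :: 'm set"] by auto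
  have less1: "l j < 1"
    using l card by (rule weight_less_1)
  have w: "0 < l j"
    using l by (simp add: is_weight_def)
  have s0: "\<forall>\<^sub>F s in at_right (0::real). 0 < s"
    by (simp add: eventually_at_right_less)
  define r where "r = (\<lambda>s i. if i = j then 1 else s :: real)"
  define R where "R = (\<lambda>s. l j + (1 - l j) * s)"
  have R: "(\<Sum>i\<in>UNIV. l i * r s i) = R s" for s
    using sum_weight_if[OF l, of j 1 s] by (simp add: r_def R_def)
  have R_pos: "0 < R s" if "0 < s" for s
    using that w less1 by (simp add: R_def add_pos_pos)
  have r_pos: "0 < r s i" if "0 < s" for s i
    using that by (simp add: r_def)
  show ?thesis
  proof (cases "0 < p")
    case True
    \<comment> \<open>For positive exponents, zeros at the other indices leave only the term of
      \<open>j\<close> in both means.\<close>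
    define t where "t = (\<lambda>i. if i = j then 1 else 0 :: real)"
    have t: "0 \<le> t i" for i
      by (simp add: t_def)
    have single: "(\<lambda>i. t i * (R s / r s i) ^ d) = (\<lambda>i. if i = j then R s ^ d else 0)" for s
      by (auto simp: t_def r_def)
    have "\<exists>s>0. power_mean l q (\<lambda>i. t i * (R s / r s i) ^ d) < power_mean l p t"
    proof (cases "0 < q")
      case q0: True
      have qf: "q \<noteq> \<infinity>"
        using q by auto
      have "\<forall>\<^sub>F s in at_right 0. R s ^ d * l j powr (1 / real_of_ereal q) < power_mean l p t"
        unfolding R_def t_def using l less1 d True p q q0
        by (rule eventually_radius_power_less_pos)
      then obtain s where s: "0 < s" "R s ^ d * l j powr (1 / real_of_ereal q) < power_mean l p t"
        using eventually_happens'[OF trivial_limit_at_right_real eventually_conj[OF s0]] by blast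
      have "power_mean l q (\<lambda>i. t i * (R s / r s i) ^ d) = l j powr (1 / real_of_ereal q) * R s ^ d"
        unfolding single using l q0 qf R_pos[OF s(1)] by (intro power_mean_single) auto
      then show ?thesis
        using s by (auto simp: mult.commute)
    next
      case False
      \<comment> \<open>The zero entry at \<open>k\<close> annihilates the mean of exponent
        \<open>q\<close>, so any positive \<open>s\<close> works, in particular 1.\<close>
      have "power_mean l q (\<lambda>i. t i * (R 1 / r 1 i) ^ d) = 0"
        using False jk t R_pos[of 1] r_pos[of 1]
        by (intro power_mean_nonpos_eq_0[of _ _ k]) (auto simp: t_def less_imp_le)
      moreover have "0 < power_mean l p t"
        unfolding t_def using l True p w by (subst power_mean_single) auto
      ultimately show ?thesis
        by (intro exI[of _ 1]) simp
    qed
    then show ?thesis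
      using t r_pos R by metis
  next
    case False
    then have p0: "p \<le> 0"
      by simp
    \<comment> \<open>The transform maps nonpositive exponents to nonpositive ones; the strict sign
      of \<open>q\<close> is what \<open>power_mean_neg_le\<close> asks for.\<close>
    have qneg: "q < 0"
    proof -
      have "power_transform d p \<le> 0"
      proof (cases p)
        case (real u)
        then have "u \<le> 0"
          using p0 by simp
        then have "u \<noteq> 1 / real d" "u / (1 - real d * u) \<le> 0"
          using d mult_nonneg_nonpos[of "real d" u] by (auto intro: divide_nonpos_nonneg)
        then show ?thesis
          using real by (simp add: power_transform_def)
      qed (use p0 in \<open>auto simp: power_transform_def\<close>)
      with q show ?thesis
        by (rule less_le_trans)
    qed
    define t where "t = (\<lambda>s i. if i = j then 1 else 1 / s :: real)"
    have "\<forall>\<^sub>F s in at_right 0. R s ^ d * l j powr (1 / real_of_ereal q) < power_mean l p (t s)"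
      unfolding R_def t_def using l less1 d p0 q by (rule eventually_radius_power_less_nonpos)
    then obtain s where s: "0 < s" "R s ^ d * l j powr (1 / real_of_ereal q) < power_mean l p (t s)"
      using eventually_happens'[OF trivial_limit_at_right_real eventually_conj[OF s0]] by blast
    have t_pos: "0 < t s i" for i
      using s by (simp add: t_def)
    \<comment> \<open>At \<open>j\<close> both \<open>t\<close> and \<open>r\<close> are 1, so the
      term of \<open>j\<close> alone bounds the mean by the left side of the inequality in
      \<open>s\<close>.\<close>
    have "power_mean l q (\<lambda>i. t s i * (R s / r s i) ^ d)
        \<le> l j powr (1 / real_of_ereal q) * (t s j * (R s / r s j) ^ d)"
      using l qneg t_pos R_pos[OF s(1)] r_pos[OF s(1)] by (intro power_mean_neg_le) auto
    also have "\<dots> < power_mean l p (t s)"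
      using s by (simp add: t_def r_def mult.commute)
    finally show ?thesis
      using t_pos r_pos[OF s(1)] R by (intro exI[of _ "t s"] exI[of _ "r s"]) (auto intro: less_imp_le)
  qed
qed

theorem proposition6p6:
  fixes l :: "'m::finite \<Rightarrow> real" and p q :: ereal
  assumes "CARD('m) \<ge> 2"
    and "is_weight l"
    and "p \<le> ereal (1 / real CARD('d::finite))"
    and "q < power_transform CARD('d) p"
  shows "\<exists>(f :: 'm \<Rightarrow> real^'d \<Rightarrow> real) (g :: 'm \<Rightarrow> real^'d \<Rightarrow> real).
    (\<forall>i. (\<forall>x. 0 \<le> f i x) \<and> (\<forall>x. 0 \<le> g i x) \<and>
         integrable lebesgue (f i) \<and> integrable lebesgue (g i) \<and> 0 < L1_norm (f i)) \<and>
    essinf (lebesgue_on {x :: real^'d^'m. \<forall>i. x $ i \<in> pos_set (f i)})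
        (\<lambda>x. ereal (power_mean l p (\<lambda>i. g i (weighted_point l x) / f i (x $ i))))
      > ereal (power_mean l q (\<lambda>i. L1_norm (g i) / L1_norm (f i)))"
proof -
  obtain t r :: "'m \<Rightarrow> real" where "\<And>i. 0 \<le> t i" "\<And>i. 0 < r i"
    "power_mean l q (\<lambda>i. t i * ((\<Sum>k\<in>UNIV. l k * r k) / r i) ^ CARD('d)) < power_mean l p t"
    using exists_power_mean_less[OF assms(1,2) _ assms(3,4)] by auto
  then show ?thesis
    using assms(2) by (intro exists_functions_if_power_mean_less) auto
qed

end
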